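(* Let $G$ be a finite simple graph that contains one of the configurations (a), (b), (c), (d) described below via an injection $f$, and suppose that the graph obtained from $G$ by the 2-switch on $\langle f(p),f(q):f(r),f(s)\rangle$ is isomorphic to $G$. Then $G$ contains one of the configurations (A), (B) described below via an injection $g$ whose image contains the image of $f$ and such that the alternating 4-cycle $\langle g(u),g(v):g(w),g(x)\rangle$ coincides with $\langle f(p),f(q):f(r),f(s)\rangle$, i.e. $\{\{g(u),g(v)\},\{g(w),g(x)\}\}=\{\{f(p),f(q)\},\{f(r),f(s)\}\}$ and $\{\{g(v),g(w)\},\{g(u),g(x)\}\}=\{\{f(q),f(r)\},\{f(p),f(s)\}\}$.
   Context: All graphs are finite and simple. An alternating 4-cycle $\langle a,b:c,d\rangle$ in a graph consists of four distinct vertices with $ab,cd$ edges and $bc,ad$ non-edges; the 2-switch on it deletes $ab,cd$ and adds $bc,ad$. A configuration is a triple $(V,E,F)$ with $(V,E)$ a graph and $F$ a set of vertex pairs not in $E$ (non-edges). A graph $G$ contains $(V,E,F)$ via an injection $f:V\to V(G)$ if $f(x)f(y)\in E(G)$ for all $xy\in E$ and $f(x)f(y)\notin E(G)$ for all $xy\in F$ (other pairs unconstrained). The configurations are: (a) vertices $p,q,r,s,w$; edges $pq,rs,qw,rw$; non-edges $qr,ps,pw,sw$. (b) vertices $p,q,r,s,w$; edges $pq,rs,pw,qw$; non-edges $qr,ps,rw,sw$. (c) vertices $p,q,r,s,y,z$; edges $pq,rs,pz,qy$; non-edges $qr,ps,rz,sy$. (d) vertices $p,q,r,s,y,z$; edges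 $pq,rs,ry,qz$; non-edges $qr,ps,py,sz$. (A) vertices $u,v,w,x,y,z$; edges $uv,wx,vy,wy,uz,vz$; non-edges $vw,ux,uy,xy,wz,xz$. (B) vertices $u,v,w,x,y,z,t$; edges $uv,wx,vy,uz,wt$; non-edges $vw,ux,xy,wz,ut$. *)

theory Defs
  imports Main
begin

type_synonym 'a ugraph = "'a set \<times> 'a set set"

type_synonym 'v config = "'v set \<times> 'v set set \<times> 'v set set"

definition vertex_pairs :: "'a set \<Rightarrow> 'a set set" where
  "vertex_pairs V = {e. e \<subseteq> V \<and> card e = 2}"

fun finite_simple_graph :: "'a ugraph \<Rightarrow> bool" where
  "finite_simple_graph (V, E) \<longleftrightarrow> finite V \<and> E \<subseteq> vertex_pairs V"

fun graph_isomorphic :: "'a ugraph \<Rightarrow> 'b ugraph \<Rightarrow> bool" where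
  "graph_isomorphic (V, E) (V', E') \<longleftrightarrow>
     (\<exists>h. bij_betw h V V' \<and> (\<forall>x\<in>V. \<forall>y\<in>V. {x, y} \<in> E \<longleftrightarrow> {h x, h y} \<in> E'))"

fun alternating_4_cycle :: "'a ugraph \<Rightarrow> 'a \<Rightarrow> 'a \<Rightarrow> 'a \<Rightarrow> 'a \<Rightarrow> bool" where
  "alternating_4_cycle (V, E) a b c d \<longleftrightarrow>
     {a, b, c, d} \<subseteq> V \<and> distinct [a, b, c, d] \<and>
     {a, b} \<in> E \<and> {c, d} \<in> E \<and> {b, c} \<notin> E \<and> {a, d} \<notin> E"

fun two_switch :: "'a ugraph \<Rightarrow> 'a \<Rightarrow> 'a \<Rightarrow> 'a \<Rightarrow> 'a \<Rightarrow> 'a ugraph" where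
  "two_switch (V, E) a b c d = (V, (E - {{a, b}, {c, d}}) \<union> {{b, c}, {a, d}})"

fun is_config :: "'v config \<Rightarrow> bool" where
  "is_config (V, E, F) \<longleftrightarrow>
     finite_simple_graph (V, E) \<and> F \<subseteq> vertex_pairs V \<and> F \<inter> E = {}"

definition config_verts :: "'v config \<Rightarrow> 'v set" where
  "config_verts C = fst C"

fun contains_via :: "'a ugraph \<Rightarrow> 'v config \<Rightarrow> ('v \<Rightarrow> 'a) \<Rightarrow> bool" where
  "contains_via (VG, EG) (V, E, F) f \<longleftrightarrow>
     inj_on f V \<and> f ` V \<subseteq> VG \<and>
     (\<forall>e\<in>E. f ` e \<in> EG) \<and> (\<forall>e\<in>F. f ` e \<notin> EG)"

text \<open>The label \<open>lp\<close> stands for the vertex \<open>p\<close> of a configuration, and so on.\<close>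

datatype label = lp | lq | lr | ls | lt | lu | lv | lw | lx | ly | lz

definition config_a :: "label config" where
  "config_a = ({lp, lq, lr, ls, lw},
     {{lp, lq}, {lr, ls}, {lq, lw}, {lr, lw}},
     {{lq, lr}, {lp, ls}, {lp, lw}, {ls, lw}})"

definition config_b :: "label config" where
  "config_b = ({lp, lq, lr, ls, lw},
     {{lp, lq}, {lr, ls}, {lp, lw}, {lq, lw}},
     {{lq, lr}, {lp, ls}, {lr, lw}, {ls, lw}})"

definition config_c :: "label config" where
  "config_c = ({lp, lq, lr, ls, ly, lz},
     {{lp, lq}, {lr, ls}, {lp, lz}, {lq, ly}},
     {{lq, lr}, {lp, ls}, {lr, lz}, {ls, ly}})"

definition config_d :: "label config" where
  "config_d = ({lp, lq, lr, ls, ly, lz},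
     {{lp, lq}, {lr, ls}, {lr, ly}, {lq, lz}},
     {{lq, lr}, {lp, ls}, {lp, ly}, {ls, lz}})"

definition config_A :: "label config" where
  "config_A = ({lu, lv, lw, lx, ly, lz},
     {{lu, lv}, {lw, lx}, {lv, ly}, {lw, ly}, {lu, lz}, {lv, lz}},
     {{lv, lw}, {lu, lx}, {lu, ly}, {lx, ly}, {lw, lz}, {lx, lz}})"

definition config_B :: "label config" where
  "config_B = ({lu, lv, lw, lx, ly, lz, lt},
     {{lu, lv}, {lw, lx}, {lv, ly}, {lu, lz}, {lw, lt}},
     {{lv, lw}, {lu, lx}, {lx, ly}, {lw, lz}, {lu, lt}})"

lemma is_config_configs:
  "C \<in> {config_a, config_b, config_c, config_d, config_A, config_B} \<Longrightarrow> is_config C"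
  by (auto simp: config_a_def config_b_def config_c_def config_d_def
      config_A_def config_B_def vertex_pairs_def doubleton_eq_iff)

lemma contains_via_alternating_4_cycle:
  assumes "C \<in> {config_a, config_b, config_c, config_d}" and "contains_via G C f"
  shows "alternating_4_cycle G (f lp) (f lq) (f lr) (f ls)"
  using assms
  by (cases G) (auto simp: config_a_def config_b_def config_c_def config_d_def)

lemma contains_via_alternating_4_cycle':
  assumes "C \<in> {config_A, config_B}" and "contains_via G C g"
  shows "alternating_4_cycle G (g lu) (g lv) (g lw) (g lx)"
  using assms by (cases G) (auto simp: config_A_def config_B_def)

end

theory Submission imports Defs begin

text \<open>
  For an alternating 4-cycle \<open>\<langle>p,q:r,s\<rangle>\<close> let \<open>P\<close>, \<open>Q\<close>, \<open>R\<close>, \<open>S\<close> be the sets of vertices off the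
  cycle that lie in \<open>N(p) - N(r)\<close>, \<open>N(q) - N(s)\<close>, \<open>N(r) - N(p)\<close>, \<open>N(s) - N(q)\<close>. Up to the
  symmetries of the cycle, (B) says that three distinct vertices represent three of these sets,
  and (A) that both \<open>(P \<inter> Q) \<union> (R \<inter> S)\<close> and \<open>(Q \<inter> R) \<union> (P \<inter> S)\<close> are inhabited.

  Two isomorphism invariants suffice. The sum of \<open>d(x) d(y)\<close> over all edges \<open>xy\<close> changes by
  \<open>(d(q) - d(s)) (d(r) - d(p))\<close> under the switch, so \<open>|P| = |R|\<close> or \<open>|Q| = |S|\<close>. The number of
  triangles changes by the sum of \<open>([x \<in> N(r)] - [x \<in> N(p)]) ([x \<in> N(q)] - [x \<in> N(s)])\<close> over the
  vertices \<open>x\<close> off the cycle, so one of the two unions above is inhabited iff the other is, which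
  settles (a) and (b). In (c) and (d) there are distinct \<open>y \<in> P \<union> R\<close> and \<open>z \<in> Q \<union> S\<close>. If, say,
  \<open>|P| = |R|\<close> and \<open>y \<in> P\<close>, then some element of \<open>R\<close> other than \<open>z\<close> yields (B), or else \<open>P = {y}\<close> and
  \<open>R = {z}\<close>, and then the triangle count puts \<open>y\<close> into the union not containing \<open>z\<close>, which is (A).
\<close>

section \<open>Two isomorphism invariants\<close>

definition neighbours :: "'a set set \<Rightarrow> 'a \<Rightarrow> 'a set" where
  "neighbours E x = {y. {x, y} \<in> E}"

text \<open>This is the second Zagreb index of the graph.\<close>

definition degree_product_sum :: "'a set set \<Rightarrow> nat" where
  "degree_product_sum E = (\<Sum>e\<in>E. \<Prod>x\<in>e. card (neighbours E x))"

definition triangles :: "'a set set \<Rightarrow> 'a set set" where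
  "triangles E = {T. card T = 3 \<and> (\<forall>x\<in>T. \<forall>y\<in>T. x \<noteq> y \<longrightarrow> {x, y} \<in> E)}"

lemma edge_obtain:
  assumes "E \<subseteq> vertex_pairs V" "e \<in> E"
  obtains x y where "e = {x, y}" "x \<in> V" "y \<in> V"
proof -
  have "e \<subseteq> V" "card e = 2" using assms by (auto simp: vertex_pairs_def)
  then show thesis using that by (auto simp: card_2_iff)
qed

lemma edgeD:
  assumes "E \<subseteq> vertex_pairs V" "{x, y} \<in> E"
  shows "x \<in> V" "y \<in> V" "x \<noteq> y"
proof -
  have "{x, y} \<subseteq> V" "card {x, y} = 2" using assms by (auto simp: vertex_pairs_def)
  then show "x \<in> V" "y \<in> V" "x \<noteq> y" by auto
qed

lemma triangle_subset:
  assumes "E \<subseteq> vertex_pairs V" "T \<in> triangles E"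
  shows "T \<subseteq> V"
proof
  fix x assume x: "x \<in> T"
  have c: "card T = 3" using assms by (simp add: triangles_def)
  have "\<not> T \<subseteq> {x}" using card_mono[of "{x}" T] c by auto
  then obtain y where "y \<in> T" "x \<noteq> y" by blast
  then have "{x, y} \<in> E" using assms(2) x by (simp add: triangles_def)
  then show "x \<in> V" by (rule edgeD(1)[OF assms(1)])
qed

section \<open>Transport of degrees, edges and triangles along an isomorphism\<close>

locale graph_iso =
  fixes V :: "'a set" and E :: "'a set set" and V' :: "'b set" and E' :: "'b set set" and h
  assumes edges: "E \<subseteq> vertex_pairs V" and edges': "E' \<subseteq> vertex_pairs V'"
    and bij: "bij_betw h V V'"
    and adj: "\<And>x y. x \<in> V \<Longrightarrow> y \<in> V \<Longrightarrow> {x, y} \<in> E \<longleftrightarrow> {h x, h y} \<in> E'"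
begin

lemma inj: "inj_on h V" and im: "h ` V = V'"
  using bij by (auto simp: bij_betw_def)

lemma inj_image: "inj_on ((`) h) (Pow V)"
  using inj by (metis inj_on_image_Pow)

lemma neighbours_iso:
  assumes "x \<in> V"
  shows "neighbours E' (h x) = h ` neighbours E x"
proof (intro equalityI subsetI)
  fix y assume "y \<in> neighbours E' (h x)"
  then have y: "{h x, y} \<in> E'" by (simp add: neighbours_def)
  then obtain z where "z \<in> V" "y = h z"
    using edgeD(2)[OF edges'] im by blast
  then show "y \<in> h ` neighbours E x"
    using y adj[OF assms] by (auto simp: neighbours_def)
next
  fix y assume "y \<in> h ` neighbours E x"
  then show "y \<in> neighbours E' (h x)"
    using adj[OF assms] edgeD(2)[OF edges, of x] by (auto simp: neighbours_def)
qed

lemma degree_iso: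
  assumes "x \<in> V"
  shows "card (neighbours E' (h x)) = card (neighbours E x)"
proof -
  have "neighbours E x \<subseteq> V" using edgeD(2)[OF edges] by (auto simp: neighbours_def)
  then show ?thesis
    unfolding neighbours_iso[OF assms] using inj by (intro card_image) (rule inj_on_subset)
qed

lemma edges_iso: "bij_betw ((`) h) E E'"
proof -
  have "E \<subseteq> Pow V" using edges by (auto simp: vertex_pairs_def)
  then have "inj_on ((`) h) E" using inj_image inj_on_subset by blast
  moreover have "(`) h ` E = E'"
  proof (intro equalityI subsetI)
    fix e assume "e \<in> (`) h ` E"
    then obtain d where d: "d \<in> E" "e = h ` d" by blast
    obtain x y where "d = {x, y}" "x \<in> V" "y \<in> V" using edge_obtain[OF edges d(1)] .
    then show "e \<in> E'" using d adj by simp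
  next
    fix e assume e: "e \<in> E'"
    obtain x y where xy: "e = {x, y}" "x \<in> V'" "y \<in> V'" using edge_obtain[OF edges' e] .
    then obtain a b where "a \<in> V" "b \<in> V" "x = h a" "y = h b" using im by blast
    then show "e \<in> (`) h ` E"
      using adj e xy by (intro image_eqI[of _ _ "{a, b}"]) auto
  qed
  ultimately show ?thesis by (simp add: bij_betw_def)
qed

lemma degree_product_sum_iso: "degree_product_sum E' = degree_product_sum E"
proof -
  have "degree_product_sum E' = (\<Sum>e\<in>E. \<Prod>x\<in>h ` e. card (neighbours E' x))"
    unfolding degree_product_sum_def by (rule sum.reindex_bij_betw[OF edges_iso, symmetric])
  also have "\<dots> = (\<Sum>e\<in>E. \<Prod>x\<in>e. card (neighbours E x))"
  proof (rule sum.cong[OF refl])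
    fix e assume "e \<in> E"
    then have e: "e \<subseteq> V" using edges by (auto simp: vertex_pairs_def)
    then have "inj_on h e" using inj inj_on_subset by blast
    then show "(\<Prod>x\<in>h ` e. card (neighbours E' x)) = (\<Prod>x\<in>e. card (neighbours E x))"
      using e by (auto simp: prod.reindex degree_iso intro!: prod.cong)
  qed
  finally show ?thesis by (simp add: degree_product_sum_def)
qed

lemma card_triangles_iso: "card (triangles E') = card (triangles E)"
proof -
  have sub: "triangles E \<subseteq> Pow V" using triangle_subset[OF edges] by blast
  have "triangles E' = (`) h ` triangles E"
  proof (intro equalityI subsetI)
    fix T assume T: "T \<in> triangles E'"
    define U where "U = {x\<in>V. h x \<in> T}"
    have hU: "T = h ` U"
      using triangle_subset[OF edges' T] im by (auto simp: U_def)
    have "inj_on h U" using inj by (rule inj_on_subset) (auto simp: U_def)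
    then have "card U = 3" using T hU by (simp add: triangles_def card_image)
    moreover have "{x, y} \<in> E" if "x \<in> U" "y \<in> U" "x \<noteq> y" for x y
      using that T adj[of x y] inj by (auto simp: U_def triangles_def inj_on_def)
    ultimately have "U \<in> triangles E" by (simp add: triangles_def)
    then show "T \<in> (`) h ` triangles E" using hU by blast
  next
    fix T assume "T \<in> (`) h ` triangles E"
    then obtain U where U: "U \<in> triangles E" "T = h ` U" by blast
    have UV: "U \<subseteq> V" using triangle_subset[OF edges U(1)] .
    then have "card T = 3"
      using U inj_on_subset[OF inj UV] by (simp add: triangles_def card_image)
    moreover have "{h x, h y} \<in> E'" if "x \<in> U" "y \<in> U" "h x \<noteq> h y" for x y
    proof -
      have "{x, y} \<in> E" using that U(1) by (auto simp: triangles_def)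
      then show ?thesis using that UV adj by blast
    qed
    ultimately show "T \<in> triangles E'" by (auto simp: U(2) triangles_def)
  qed
  then show ?thesis
    using card_image[OF inj_on_subset[OF inj_image sub]] by simp
qed

end

text \<open>The new triangles are exactly the sets {a, b, x} with x a common neighbour of a and b,
  and different x give different triangles.\<close>

lemma card_triangles_insert:
  assumes E: "E \<subseteq> vertex_pairs V" and fin: "finite V"
    and ab: "a \<noteq> b" "{a, b} \<notin> E"
  shows "card (triangles (insert {a, b} E)) =
    card (triangles E) + card (neighbours E a \<inter> neighbours E b)"
proof -
  define N where "N = neighbours E a \<inter> neighbours E b"
  have N: "x \<in> N \<longleftrightarrow> {a, x} \<in> E \<and> {b, x} \<in> E" for x by (simp add: N_def neighbours_def)
  have NV: "N \<subseteq> V" "a \<notin> N" "b \<notin> N"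
    using edgeD(2)[OF E, of a] edgeD(3)[OF E, of a a] edgeD(3)[OF E, of b b] by (auto simp: N)
  have "triangles (insert {a, b} E) = triangles E \<union> (\<lambda>x. {a, b, x}) ` N"
  proof (intro equalityI subsetI)
    fix T assume T: "T \<in> triangles (insert {a, b} E)"
    show "T \<in> triangles E \<union> (\<lambda>x. {a, b, x}) ` N"
    proof (cases "{a, b} \<subseteq> T")
      case True
      have c: "card T = 3" using T by (simp add: triangles_def)
      then have "finite T" using card.infinite by fastforce
      then have "card (T - {a, b}) = 1"
        using c True ab by (simp add: card_Diff_subset)
      then obtain x where "T - {a, b} = {x}" by (rule card_1_singletonE)
      then have x: "T = {a, b, x}" "x \<noteq> a" "x \<noteq> b" using True by blast+
      then have "{a, x} \<in> E" "{b, x} \<in> E"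
        using T ab by (auto simp: triangles_def doubleton_eq_iff)
      then show ?thesis using x N by blast
    next
      case False
      then show ?thesis using T by (auto simp: triangles_def doubleton_eq_iff)
    qed
  next
    fix T assume "T \<in> triangles E \<union> (\<lambda>x. {a, b, x}) ` N"
    then show "T \<in> triangles (insert {a, b} E)"
    proof
      assume "T \<in> (\<lambda>x. {a, b, x}) ` N"
      then obtain x where x: "x \<in> N" "T = {a, b, x}" by blast
      then have "x \<noteq> a" "x \<noteq> b" using NV by auto
      then show ?thesis using x ab N by (auto simp: triangles_def insert_commute)
    qed (auto simp: triangles_def)
  qed
  moreover have "triangles E \<inter> (\<lambda>x. {a, b, x}) ` N = {}"
    using ab by (auto simp: triangles_def)
  moreover have "inj_on (\<lambda>x. {a, b, x}) N"
    using NV by (auto simp: inj_on_def)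
  moreover have "finite (triangles E)"
    using finite_subset[of "triangles E" "Pow V"] triangle_subset[OF E] fin by blast
  moreover have "finite N" using NV fin finite_subset by blast
  ultimately show ?thesis
    by (simp add: card_Un_disjoint card_image flip: N_def)
qed

text \<open>Each set exceeds its difference by the same amount \<open>card (A \<inter> B)\<close>.
  This later turns equal degrees into equally large sides.\<close>

lemma card_Diff_eq_iff:
  assumes "finite A" "finite B"
  shows "card (A - B) = card (B - A) \<longleftrightarrow> card A = card B"
proof -
  have "card A = card (A - B) + card (A \<inter> B)" "card B = card (B - A) + card (A \<inter> B)"
    using assms by (auto simp: card_Diff_subset_Int Int_commute card_mono)
  then show ?thesis by simp
qed

section \<open>Switches producing an isomorphic graph\<close>

text \<open>\<open>side V E p q r s\<close> is the set \<open>P\<close>. The argument order makes \<open>Q\<close>, \<open>R\<close>, \<open>S\<close> the images of \<open>P\<close>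
  under the symmetries \<open>\<langle>q,p:s,r\<rangle>\<close>, \<open>\<langle>r,s:p,q\<rangle>\<close>, \<open>\<langle>s,r:q,p\<rangle>\<close> of the alternating 4-cycle.\<close>

definition side :: "'a set \<Rightarrow> 'a set set \<Rightarrow> 'a \<Rightarrow> 'a \<Rightarrow> 'a \<Rightarrow> 'a \<Rightarrow> 'a set" where
  "side V E a b c d = {x \<in> V - {a, b, c, d}. {a, x} \<in> E \<and> {c, x} \<notin> E}"

text \<open>\<open>X\<close> collects the vertices that the image has to cover. The cycle enters
  only through unordered pairs, so the predicate is invariant under the symmetries of the
  cycle.\<close>

definition extends_to_AB ::
  "'a set \<Rightarrow> 'a set set \<Rightarrow> 'a \<Rightarrow> 'a \<Rightarrow> 'a \<Rightarrow> 'a \<Rightarrow> 'a set \<Rightarrow> bool" where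
  "extends_to_AB V E p q r s X \<longleftrightarrow> (\<exists>D\<in>{config_A, config_B}. \<exists>g :: label \<Rightarrow> 'a.
    contains_via (V, E) D g \<and> X \<subseteq> g ` config_verts D \<and>
    {{g lu, g lv}, {g lw, g lx}} = {{p, q}, {r, s}} \<and>
    {{g lv, g lw}, {g lu, g lx}} = {{q, r}, {p, s}})"

lemma extends_to_AB_sym:
  "extends_to_AB V E q p s r X = extends_to_AB V E p q r s X"
  "extends_to_AB V E r s p q X = extends_to_AB V E p q r s X"
  by (simp_all add: extends_to_AB_def insert_commute)

text \<open>The cycle vertices are locale parameters so that a result for one labelling can be
  instantiated at the symmetric ones.\<close>

locale isomorphic_switch =
  fixes V :: "'a set" and E :: "'a set set" and p q r s :: 'a
  assumes simple: "finite_simple_graph (V, E)"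
    and alt: "alternating_4_cycle (V, E) p q r s"
    and iso: "graph_isomorphic (two_switch (V, E) p q r s) (V, E)"
begin

abbreviation "P \<equiv> side V E p q r s"
abbreviation "Q \<equiv> side V E q p s r"
abbreviation "R \<equiv> side V E r s p q"
abbreviation "S \<equiv> side V E s r q p"

text \<open>A symmetric labelling describes the same switch. This one exchanges \<open>P\<close>
  with \<open>Q\<close> and \<open>R\<close> with \<open>S\<close>; the next one exchanges
  \<open>P\<close> with \<open>R\<close> and \<open>Q\<close> with \<open>S\<close>.\<close>

lemma swap_edges_ends: "isomorphic_switch V E q p s r"
  using simple alt iso
  by (auto simp: isomorphic_switch_def insert_commute simp del: graph_isomorphic.simps)

lemma swap_edges: "isomorphic_switch V E r s p q"
  using simple alt iso
  by (auto simp: isomorphic_switch_def insert_commute simp del: graph_isomorphic.simps)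

lemma fin: "finite V" and edges: "E \<subseteq> vertex_pairs V"
  using simple by auto

lemma cycle:
  "p \<in> V" "q \<in> V" "r \<in> V" "s \<in> V"
  "p \<noteq> q" "p \<noteq> r" "p \<noteq> s" "q \<noteq> r" "q \<noteq> s" "r \<noteq> s"
  "{p, q} \<in> E" "{r, s} \<in> E" "{q, r} \<notin> E" "{p, s} \<notin> E"
  using alt by auto

text \<open>The graph before and the graph after the switch both arise from this one by adding two
  disjoint edges, so they are compared through it.\<close>

definition "common = E - {{p, q}, {r, s}}"

definition "switched = insert {q, r} (insert {p, s} common)"

lemma E_eq: "E = insert {p, q} (insert {r, s} common)"
  using cycle by (auto simp: common_def)

lemma common_edges: "common \<subseteq> vertex_pairs V" and switched_edges: "switched \<subseteq> vertex_pairs V"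
  using edges cycle by (auto simp: common_def switched_def vertex_pairs_def)

lemma not_common: "{p, q} \<notin> common" "{r, s} \<notin> common" "{q, r} \<notin> common" "{p, s} \<notin> common"
  using cycle by (auto simp: common_def)

lemma finite_common: "finite common"
proof (rule finite_subset)
  show "common \<subseteq> Pow V" using common_edges by (auto simp: vertex_pairs_def)
qed (use fin in simp)

lemma finite_neighbours: "finite (neighbours common x)"
proof (rule finite_subset)
  show "neighbours common x \<subseteq> V" using edgeD(2)[OF common_edges, of x] by (auto simp: neighbours_def)
qed (rule fin)

lemma neighbours_E:
  "neighbours E x = (if x = p then insert q else if x = q then insert p
     else if x = r then insert s else if x = s then insert r else id) (neighbours common x)"
  using cycle by (subst E_eq) (auto simp: neighbours_def doubleton_eq_iff)

lemma neighbours_switched: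
  "neighbours switched x = (if x = p then insert s else if x = q then insert r
     else if x = r then insert q else if x = s then insert p else id) (neighbours common x)"
  using cycle by (auto simp: switched_def neighbours_def doubleton_eq_iff)

lemma not_neighbours:
  "q \<notin> neighbours common p" "s \<notin> neighbours common p"
  "p \<notin> neighbours common q" "r \<notin> neighbours common q"
  "q \<notin> neighbours common r" "s \<notin> neighbours common r"
  "p \<notin> neighbours common s" "r \<notin> neighbours common s"
  using not_common by (auto simp: neighbours_def insert_commute)

text \<open>Each cycle vertex lies on exactly one of the deleted and one of the added edges; other
  vertices lie on none.\<close>

lemma degree_E: "card (neighbours E x) =
    card (neighbours common x) + (if x \<in> {p, q, r, s} then 1 else 0)"
  and degree_switched: "card (neighbours switched x) = card (neighbours E x)"
  using not_neighbours finite_neighbours by (auto simp: neighbours_E neighbours_switched)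

lemma switch_iso: obtains h where "graph_iso V switched V E h"
proof -
  have "two_switch (V, E) p q r s = (V, switched)"
    by (auto simp: switched_def common_def)
  then obtain h where "bij_betw h V V"
    "\<forall>x\<in>V. \<forall>y\<in>V. {x, y} \<in> switched \<longleftrightarrow> {h x, h y} \<in> E"
    using iso by auto
  then show ?thesis
    using that switched_edges edges by (auto simp: graph_iso_def)
qed

text \<open>As the switch keeps all degrees, the edges in \<open>common\<close> contribute the same
  \<open>W\<close> to both degree product sums. What remains factors over the integers.\<close>

lemma equal_degrees:
  "card (neighbours common p) = card (neighbours common r) \<or>
   card (neighbours common q) = card (neighbours common s)"
proof -
  define d where "d x = card (neighbours E x)" for x
  define W where "W = (\<Sum>e\<in>common. \<Prod>x\<in>e. d x)"
  have "degree_product_sum E = d p * d q + (d r * d s + W)"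
    unfolding degree_product_sum_def d_def[symmetric]
    using cycle not_common finite_common
    by (subst E_eq) (auto simp: doubleton_eq_iff W_def)
  moreover have "degree_product_sum switched = d q * d r + (d p * d s + W)"
    unfolding degree_product_sum_def degree_switched d_def[symmetric]
    using cycle not_common finite_common
    by (auto simp: switched_def doubleton_eq_iff W_def)
  moreover have "degree_product_sum E = degree_product_sum switched"
    using switch_iso graph_iso.degree_product_sum_iso by metis
  ultimately have "int (d p * d q + d r * d s) = int (d q * d r + d p * d s)" by simp
  then have "(int (d q) - int (d s)) * (int (d p) - int (d r)) = 0"
    by (simp add: algebra_simps)
  \<comment> \<open>All four cycle vertices lose exactly one neighbour on passing to
    \<open>common\<close>, so equal degrees stay equal.\<close>
  then show ?thesis by (auto simp: d_def degree_E)
qed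

section \<open>Sides and triangle counts in terms of the common graph\<close>

lemma mem_E_iff:
  assumes "x \<notin> {p, q, r, s}"
  shows "{a, x} \<in> E \<longleftrightarrow> x \<in> neighbours common a"
  using assms by (auto simp: common_def neighbours_def doubleton_eq_iff)

lemma neighbours_in_V: "x \<in> neighbours common a \<Longrightarrow> x \<in> V \<and> x \<noteq> a"
  using edgeD(2,3)[OF common_edges, of a x] by (auto simp: neighbours_def)

lemma side_eq:
  assumes "{a, b, c, d} = {p, q, r, s}"
  shows "side V E a b c d = neighbours common a - neighbours common c - {p, q, r, s}"
proof -
  have "{a, x} \<in> E \<and> {c, x} \<notin> E \<longleftrightarrow> x \<in> neighbours common a \<and> x \<notin> neighbours common c"
    if "x \<notin> {p, q, r, s}" for x
    using mem_E_iff[OF that] by simp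
  then show ?thesis
    unfolding side_def assms using neighbours_in_V by blast
qed

lemma sides_eq:
  "P = neighbours common p - neighbours common r - {p, q, r, s}"
  "Q = neighbours common q - neighbours common s - {p, q, r, s}"
  "R = neighbours common r - neighbours common p - {p, q, r, s}"
  "S = neighbours common s - neighbours common q - {p, q, r, s}"
  by (rule side_eq; blast)+

text \<open>The vertices p and r may be adjacent. Once they are removed from each other's
  neighbourhoods, no cycle vertex is left there, and the two differences are the sides.\<close>

lemma card_side_eq:
  assumes "card (neighbours common p) = card (neighbours common r)"
  shows "card P = card R"
proof -
  let ?A = "neighbours common p - {r}" and ?B = "neighbours common r - {p}"
  have "r \<in> neighbours common p \<longleftrightarrow> p \<in> neighbours common r"
    by (simp add: neighbours_def insert_commute)
  then have "card ?A = card ?B" using assms by (cases "r \<in> neighbours common p") auto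
  then have "card (?A - ?B) = card (?B - ?A)"
    using finite_neighbours by (subst card_Diff_eq_iff) auto
  moreover have "?A - ?B = P" "?B - ?A = R"
    using neighbours_in_V not_neighbours unfolding sides_eq by blast+
  ultimately show ?thesis by simp
qed

text \<open>Starting from \<open>common\<close>, each graph is built by adding two edges. These are
  disjoint, so the first leaves the neighbourhoods of the ends of the second unchanged, and both
  increments are counted in \<open>common\<close>.\<close>

lemma triangle_balance:
  "card (neighbours common p \<inter> neighbours common q) + card (neighbours common r \<inter> neighbours common s)
   = card (neighbours common q \<inter> neighbours common r) + card (neighbours common p \<inter> neighbours common s)"
proof -
  have rs: "insert {r, s} common \<subseteq> vertex_pairs V" and ps: "insert {p, s} common \<subseteq> vertex_pairs V"
    using E_eq edges switched_edges switched_def by auto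
  have "neighbours (insert {r, s} common) p = neighbours common p"
    "neighbours (insert {r, s} common) q = neighbours common q"
    "neighbours (insert {p, s} common) q = neighbours common q"
    "neighbours (insert {p, s} common) r = neighbours common r"
    using cycle by (auto simp: neighbours_def doubleton_eq_iff)
  moreover have "{p, q} \<notin> insert {r, s} common" "{q, r} \<notin> insert {p, s} common"
    using cycle not_common by (auto simp: doubleton_eq_iff)
  ultimately have "card (triangles E) = card (triangles common)
      + card (neighbours common r \<inter> neighbours common s) + card (neighbours common p \<inter> neighbours common q)"
    and "card (triangles switched) = card (triangles common)
      + card (neighbours common p \<inter> neighbours common s) + card (neighbours common q \<inter> neighbours common r)"
    using card_triangles_insert[OF rs fin, of p q] card_triangles_insert[OF ps fin, of q r]
      card_triangles_insert[OF common_edges fin, of r s]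
      card_triangles_insert[OF common_edges fin, of p s] cycle not_common
    by (simp_all add: switched_def flip: E_eq)
  moreover have "card (triangles E) = card (triangles switched)"
    using switch_iso graph_iso.card_triangles_iso by metis
  ultimately show ?thesis by simp
qed

text \<open>The weight \<open>D\<close> sums to zero by the triangle balance. It is positive exactly
  on the first union and negative exactly on the second, so neither sign occurs alone.\<close>

lemma diagonals_inhabited_iff:
  "(P \<inter> Q) \<union> (R \<inter> S) \<noteq> {} \<longleftrightarrow> (Q \<inter> R) \<union> (P \<inter> S) \<noteq> {}"
proof -
  define N where "N = neighbours common"
  define i where "i a x = (of_bool (x \<in> N a) :: int)" for a x
  define D where "D x = (i p x - i r x) * (i q x - i s x)" for x
  define O' where "O' = V - {p, q, r, s}"
  have finO: "finite O'" using fin by (simp add: O'_def)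
  have card_eq: "int (card (N a \<inter> N b)) = (\<Sum>x\<in>O'. i a x * i b x)" if "N a \<inter> N b \<subseteq> O'" for a b
  proof -
    have "int (card (N a \<inter> N b)) = (\<Sum>x\<in>N a \<inter> N b. i a x * i b x)" by (simp add: i_def)
    also have "\<dots> = (\<Sum>x\<in>O'. i a x * i b x)"
      using that finO by (intro sum.mono_neutral_left) (auto simp: i_def)
    finally show ?thesis .
  qed
  \<comment> \<open>In \<open>common\<close> a cycle vertex can be adjacent only to the opposite
    one, so consecutive cycle vertices have no common neighbour on the cycle.\<close>
  have "N p \<inter> N q \<subseteq> O'" "N r \<inter> N s \<subseteq> O'" "N q \<inter> N r \<subseteq> O'" "N p \<inter> N s \<subseteq> O'"
    using neighbours_in_V not_neighbours by (auto simp: O'_def N_def)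
  then have "(\<Sum>x\<in>O'. i p x * i q x) + (\<Sum>x\<in>O'. i r x * i s x)
      = (\<Sum>x\<in>O'. i q x * i r x) + (\<Sum>x\<in>O'. i p x * i s x)"
    using triangle_balance by (simp flip: N_def card_eq of_nat_add)
  then have sum0: "(\<Sum>x\<in>O'. D x) = 0"
    by (simp add: D_def algebra_simps sum.distrib sum_subtractf)
  have pos: "0 < D x \<longleftrightarrow> x \<in> (P \<inter> Q) \<union> (R \<inter> S)" if "x \<in> O'" for x
    using that unfolding sides_eq by (auto simp: O'_def D_def i_def N_def)
  have neg: "D x < 0 \<longleftrightarrow> x \<in> (Q \<inter> R) \<union> (P \<inter> S)" if "x \<in> O'" for x
    using that unfolding sides_eq by (auto simp: O'_def D_def i_def N_def)
  have sub: "P \<union> Q \<union> R \<union> S \<subseteq> O'" by (auto simp: O'_def side_def)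
  show ?thesis
  proof
    assume "(P \<inter> Q) \<union> (R \<inter> S) \<noteq> {}"
    then obtain x where x: "x \<in> O'" "x \<in> (P \<inter> Q) \<union> (R \<inter> S)" using sub by blast
    show "(Q \<inter> R) \<union> (P \<inter> S) \<noteq> {}"
    proof
      assume "(Q \<inter> R) \<union> (P \<inter> S) = {}"
      then have "\<forall>x\<in>O'. 0 \<le> D x"
        using neg by (metis empty_iff not_less)
      then have "D x = 0"
        using sum0 finO x(1) by (simp only: sum_nonneg_eq_0_iff)
      then show False using pos[OF x(1)] x(2) by (metis less_irrefl)
    qed
  next
    assume "(Q \<inter> R) \<union> (P \<inter> S) \<noteq> {}"
    then obtain x where x: "x \<in> O'" "x \<in> (Q \<inter> R) \<union> (P \<inter> S)" using sub by blast
    show "(P \<inter> Q) \<union> (R \<inter> S) \<noteq> {}"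
    proof
      assume "(P \<inter> Q) \<union> (R \<inter> S) = {}"
      then have "\<forall>x\<in>O'. D x \<le> 0"
        using pos by (metis empty_iff not_less)
      then have "D x = 0"
        using sum_nonneg_eq_0_iff[OF finO, of "\<lambda>x. - D x"] sum0 x(1) by (simp add: sum_negf)
      then show False using neg[OF x(1)] x(2) by (metis less_irrefl)
    qed
  qed
qed

section \<open>Finding (A) and (B)\<close>

lemma extends_A_base:
  assumes "y \<in> Q \<inter> R" "z \<in> P \<inter> Q"
  shows "extends_to_AB V E p q r s {p, q, r, s, y, z}"
proof -
  \<comment> \<open>The default case serves \<open>lz\<close>; the other labels it catches do not
    occur in (A).\<close>
  define g where "g l = (case l of lu \<Rightarrow> p | lv \<Rightarrow> q | lw \<Rightarrow> r | lx \<Rightarrow> s | ly \<Rightarrow> y | _ \<Rightarrow> z)" for l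
  \<comment> \<open>Membership in \<open>P\<close> and in \<open>R\<close> disagrees about adjacency
    to p.\<close>
  have "y \<noteq> z" using assms by (auto simp: side_def)
  then have "contains_via (V, E) config_A g"
    using assms cycle by (auto simp: config_A_def g_def side_def insert_commute)
  then show ?thesis
    unfolding extends_to_AB_def
    by (intro bexI[of _ config_A] exI[of _ g]) (auto simp: config_A_def config_verts_def g_def)
qed

text \<open>\<open>P\<close> and \<open>R\<close> are disjoint, so z and t differ
  automatically.\<close>

lemma extends_B_base:
  assumes "y \<in> Q" "z \<in> P" "t \<in> R" "y \<noteq> z" "y \<noteq> t"
  shows "extends_to_AB V E p q r s {p, q, r, s, y, z, t}"
proof -
  define g where "g l = (case l of lu \<Rightarrow> p | lv \<Rightarrow> q | lw \<Rightarrow> r | lx \<Rightarrow> s | ly \<Rightarrow> y | lz \<Rightarrow> z | _ \<Rightarrow> t)" for l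
  have "z \<noteq> t" using assms by (auto simp: side_def)
  then have "contains_via (V, E) config_B g"
    using assms cycle by (auto simp: config_B_def g_def side_def insert_commute)
  then show ?thesis
    unfolding extends_to_AB_def
    by (intro bexI[of _ config_B] exI[of _ g]) (auto simp: config_B_def config_verts_def g_def)
qed

text \<open>The symmetries of the cycle carry each of the four combinations of intersections to the
  one of \<open>extends_A_base\<close>.\<close>

lemma extends_A:
  assumes y: "y \<in> (Q \<inter> R) \<union> (P \<inter> S)" and z: "z \<in> (P \<inter> Q) \<union> (R \<inter> S)"
  shows "extends_to_AB V E p q r s {p, q, r, s, y, z}"
proof -
  \<comment> \<open>This is the composite of both symmetries, with labelling s, r, q, p.\<close>
  note rev = isomorphic_switch.swap_edges[OF swap_edges_ends]
  from y z consider "y \<in> Q \<inter> R" "z \<in> P \<inter> Q" | "y \<in> Q \<inter> R" "z \<in> R \<inter> S"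
    | "y \<in> P \<inter> S" "z \<in> P \<inter> Q" | "y \<in> P \<inter> S" "z \<in> R \<inter> S" by blast
  then show ?thesis
  proof cases
    case 1 then show ?thesis by (rule extends_A_base)
  next
    case 2
    then have "extends_to_AB V E s r q p {s, r, q, p, y, z}"
      by (intro isomorphic_switch.extends_A_base[OF rev]) auto
    then show ?thesis
      unfolding extends_to_AB_sym(1)[of V E r s p q] extends_to_AB_sym(2)[of V E p q r s]
      by (simp add: insert_commute)
  next
    case 3
    then have "extends_to_AB V E q p s r {q, p, s, r, y, z}"
      by (intro isomorphic_switch.extends_A_base[OF swap_edges_ends]) auto
    then show ?thesis by (simp add: extends_to_AB_sym(1)[of V E p q r s] insert_commute)
  next
    case 4
    then have "extends_to_AB V E r s p q {r, s, p, q, y, z}"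
      by (intro isomorphic_switch.extends_A_base[OF swap_edges]) auto
    then show ?thesis by (simp add: extends_to_AB_sym(2)[of V E p q r s] insert_commute)
  qed
qed

lemma extends_B:
  assumes "z \<in> Q \<union> S" "y \<in> P" "t \<in> R" "z \<noteq> y" "z \<noteq> t"
  shows "extends_to_AB V E p q r s {p, q, r, s, y, z, t}"
  using assms(1)
proof
  assume "z \<in> Q"
  then show ?thesis using extends_B_base[of z y t] assms by (simp add: insert_commute)
next
  assume "z \<in> S"
  then have "extends_to_AB V E r s p q {r, s, p, q, z, t, y}"
    using assms by (intro isomorphic_switch.extends_B_base[OF swap_edges]) auto
  then show ?thesis by (simp add: extends_to_AB_sym(2)[of V E p q r s] insert_commute)
qed

section \<open>Covering prescribed vertices off the cycle\<close>

lemma extends_mono: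
  "extends_to_AB V E p q r s X \<Longrightarrow> Y \<subseteq> X \<Longrightarrow> extends_to_AB V E p q r s Y"
  unfolding extends_to_AB_def by (meson order_trans)

lemma extends_if_balanced_P:
  assumes bal: "card P = card R" and y: "y \<in> P" and z: "z \<in> Q \<union> S" and ne: "y \<noteq> z"
  shows "extends_to_AB V E p q r s {p, q, r, s, y, z}"
proof (cases "R \<subseteq> {z}")
  case False
  then obtain t where "t \<in> R" "t \<noteq> z" by blast
  then have "extends_to_AB V E p q r s {p, q, r, s, y, z, t}"
    using extends_B[OF z y] ne by blast
  then show ?thesis by (rule extends_mono) blast
next
  case True
  have "finite P" using fin by (simp add: side_def)
  then have "card R \<noteq> 0" using bal y by (metis card_0_eq empty_iff)
  then have R: "R = {z}" using True by (metis card.empty subset_singletonD)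
  then have "card P = 1" using bal by simp
  then have P: "P = {y}" using y by (metis card_1_singletonE singletonD)
  from z show ?thesis
  proof
    assume "z \<in> Q"
    then have zd: "z \<in> (Q \<inter> R) \<union> (P \<inter> S)" using R by blast
    then obtain w where w: "w \<in> (P \<inter> Q) \<union> (R \<inter> S)" using diagonals_inhabited_iff by blast
    \<comment> \<open>This excludes \<open>w\<close> from \<open>R \<inter> S\<close>, as
      \<open>R\<close> contains only \<open>z\<close>; so \<open>w\<close> lies in \<open>P\<close>,
      whose only element is \<open>y\<close>.\<close>
    have "z \<notin> S" using \<open>z \<in> Q\<close> by (auto simp: side_def)
    then have "w = y" using w P R ne by auto
    then show ?thesis using extends_A[OF zd w] by (simp add: insert_commute)
  next
    assume "z \<in> S"
    then have zd: "z \<in> (P \<inter> Q) \<union> (R \<inter> S)" using R by blast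
    then obtain w where w: "w \<in> (Q \<inter> R) \<union> (P \<inter> S)" using diagonals_inhabited_iff by blast
    have "z \<notin> Q" using \<open>z \<in> S\<close> by (auto simp: side_def)
    then have "w = y" using w P R ne by auto
    then show ?thesis using extends_A[OF w zd] by simp
  qed
qed

lemma extends_if_balanced:
  assumes bal: "card P = card R" and y: "y \<in> P \<union> R" and z: "z \<in> Q \<union> S" and ne: "y \<noteq> z"
  shows "extends_to_AB V E p q r s {p, q, r, s, y, z}"
  using y
proof
  assume "y \<in> R"
  then have "extends_to_AB V E r s p q {r, s, p, q, y, z}"
    using assms by (intro isomorphic_switch.extends_if_balanced_P[OF swap_edges]) auto
  then show ?thesis by (simp add: extends_to_AB_sym(2)[of V E p q r s] insert_commute)
qed (use assms extends_if_balanced_P in blast)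

text \<open>This lets equal degrees of q and s serve as equal degrees of p and r for the labelling
  q, p, s, r.\<close>

lemma common_swap: "isomorphic_switch.common E q p s r = common"
  by (simp add: common_def isomorphic_switch.common_def[OF swap_edges_ends] insert_commute)

lemma extends_two:
  assumes y: "y \<in> P \<union> R" and z: "z \<in> Q \<union> S" and ne: "y \<noteq> z"
  shows "extends_to_AB V E p q r s {p, q, r, s, y, z}"
  using equal_degrees
proof
  assume "card (neighbours common p) = card (neighbours common r)"
  then show ?thesis using extends_if_balanced assms card_side_eq by blast
next
  assume "card (neighbours common q) = card (neighbours common s)"
  then have "card Q = card S"
    using isomorphic_switch.card_side_eq[OF swap_edges_ends] by (simp add: common_swap)
  then have "extends_to_AB V E q p s r {q, p, s, r, z, y}"
    using assms by (intro isomorphic_switch.extends_if_balanced[OF swap_edges_ends]) auto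
  then show ?thesis by (simp add: extends_to_AB_sym(1)[of V E p q r s] insert_commute)
qed

text \<open>This serves (a) and (b): w lies in one of the two unions, the triangle count supplies a
  vertex of the other, and together they form (A).\<close>

lemma extends_diagonal:
  assumes "w \<in> (Q \<inter> R) \<union> (P \<inter> Q)"
  shows "extends_to_AB V E p q r s {p, q, r, s, w}"
  using assms
proof
  assume w: "w \<in> Q \<inter> R"
  then obtain z where "z \<in> (P \<inter> Q) \<union> (R \<inter> S)" using diagonals_inhabited_iff by blast
  then show ?thesis using extends_A[of w z] w by (blast intro: extends_mono)
next
  assume w: "w \<in> P \<inter> Q"
  then obtain y where "y \<in> (Q \<inter> R) \<union> (P \<inter> S)" using diagonals_inhabited_iff by blast
  then show ?thesis using extends_A[of y w] w by (blast intro: extends_mono)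
qed

end

theorem theorem2p3:
  fixes G :: "'a ugraph" and C :: "label config" and f :: "label \<Rightarrow> 'a"
  assumes "finite_simple_graph G"
    and "C \<in> {config_a, config_b, config_c, config_d}"
    and "contains_via G C f"
    and "graph_isomorphic (two_switch G (f lp) (f lq) (f lr) (f ls)) G"
  shows "\<exists>D\<in>{config_A, config_B}. \<exists>g :: label \<Rightarrow> 'a.
    contains_via G D g \<and>
    f ` config_verts C \<subseteq> g ` config_verts D \<and>
    {{g lu, g lv}, {g lw, g lx}} = {{f lp, f lq}, {f lr, f ls}} \<and>
    {{g lv, g lw}, {g lu, g lx}} = {{f lq, f lr}, {f lp, f ls}}"
proof -
  obtain V E where G: "G = (V, E)" by (cases G)
  interpret isomorphic_switch V E "f lp" "f lq" "f lr" "f ls"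
    using assms contains_via_alternating_4_cycle[OF assms(2,3)]
    unfolding G by unfold_locales
  note via = assms(3)[unfolded G]
  from assms(2) consider "C = config_a" | "C = config_b" | "C = config_c" | "C = config_d" by blast
  \<comment> \<open>Each configuration only says in which sides the vertices off the cycle lie. In
    (c), z plays the part of \<open>y\<close> in \<open>extends_two\<close> and y that of
    \<open>z\<close>.\<close>
  then have "extends_to_AB V E (f lp) (f lq) (f lr) (f ls) (f ` config_verts C)"
  proof cases
    case 1
    then have "f lw \<in> Q \<inter> R" using via by (auto simp: config_a_def side_def insert_commute)
    then show ?thesis using extends_diagonal[of "f lw"] 1
      by (simp add: config_verts_def config_a_def)
  next
    case 2
    then have "f lw \<in> P \<inter> Q" using via by (auto simp: config_b_def side_def insert_commute)
    then show ?thesis using extends_diagonal[of "f lw"] 2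
      by (simp add: config_verts_def config_b_def)
  next
    case 3
    then have "f lz \<in> P" "f ly \<in> Q" "f lz \<noteq> f ly"
      using via by (auto simp: config_c_def side_def insert_commute)
    then show ?thesis using extends_two[of "f lz" "f ly"] 3
      by (simp add: config_verts_def config_c_def insert_commute)
  next
    case 4
    then have "f ly \<in> R" "f lz \<in> Q" "f ly \<noteq> f lz"
      using via by (auto simp: config_d_def side_def insert_commute)
    then show ?thesis using extends_two[of "f ly" "f lz"] 4
      by (simp add: config_verts_def config_d_def)
  qed
  then show ?thesis unfolding extends_to_AB_def G .
qed

end
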